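(* Let $p$ be a prime and let $G$ be a profinite group. If $\mu(\mathcal P_p(G))>0$, then $G$ is virtually pro-$p$.
   Context: For a profinite group $G$, $\mu$ is the normalized Haar measure of $G$, and $\langle X\rangle$ denotes the closed subgroup generated by $X\subseteq G$. $\mathcal P_p$ is the class of finite $p$-groups. For $x\in G$, $\mathcal P_{p,G}(x)=\{g\in G : \langle g,x\rangle \text{ is a pro-}p\text{ group}\}$ (a closed subset of $G$), and $\mathcal P_p(G)=\{g\in G : \mu(\mathcal P_{p,G}(g))>0\}$, which is a Borel subset of $G$. Virtually pro-$p$ means having an open pro-$p$ subgroup. *)

theory Defs
  imports "HOL-Analysis.Analysis" "HOL-Algebra.Coset" "HOL-Computational_Algebra.Primes"
begin

definition topological_group :: "('a, 'b) monoid_scheme \<Rightarrow> 'a topology \<Rightarrow> bool" where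
  "topological_group G T \<longleftrightarrow>
     group G \<and> topspace T = carrier G \<and>
     continuous_map (prod_topology T T) T (\<lambda>(x, y). x \<otimes>\<^bsub>G\<^esub> y) \<and>
     continuous_map T T (\<lambda>x. inv\<^bsub>G\<^esub> x)"

definition totally_disconnected :: "'a topology \<Rightarrow> bool" where
  "totally_disconnected T \<longleftrightarrow>
     (\<forall>x \<in> topspace T. connected_component_of_set T x = {x})"

definition profinite_group :: "('a, 'b) monoid_scheme \<Rightarrow> 'a topology \<Rightarrow> bool" where
  "profinite_group G T \<longleftrightarrow>
     topological_group G T \<and> compact_space T \<and> Hausdorff_space T \<and> totally_disconnected T"

definition finite_p_group :: "nat \<Rightarrow> ('a, 'b) monoid_scheme \<Rightarrow> bool" where
  "finite_p_group p G \<longleftrightarrow> group G \<and> finite (carrier G) \<and> (\<exists>n. order G = p ^ n)"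

definition pro_p_group :: "nat \<Rightarrow> ('a, 'b) monoid_scheme \<Rightarrow> 'a topology \<Rightarrow> bool" where
  "pro_p_group p G T \<longleftrightarrow>
     profinite_group G T \<and>
     (\<forall>N. N \<lhd> G \<longrightarrow> openin T N \<longrightarrow> finite_p_group p (G Mod N))"

definition pro_p_subgroup ::
  "nat \<Rightarrow> ('a, 'b) monoid_scheme \<Rightarrow> 'a topology \<Rightarrow> 'a set \<Rightarrow> bool" where
  "pro_p_subgroup p G T H \<longleftrightarrow>
     subgroup H G \<and> pro_p_group p (G\<lparr>carrier := H\<rparr>) (subtopology T H)"

definition virtually_pro_p :: "nat \<Rightarrow> ('a, 'b) monoid_scheme \<Rightarrow> 'a topology \<Rightarrow> bool" where
  "virtually_pro_p p G T \<longleftrightarrow> (\<exists>H. openin T H \<and> pro_p_subgroup p G T H)"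

definition closed_subgroup_generated ::
  "('a, 'b) monoid_scheme \<Rightarrow> 'a topology \<Rightarrow> 'a set \<Rightarrow> 'a set" where
  "closed_subgroup_generated G T X = \<Inter>{H. subgroup H G \<and> closedin T H \<and> X \<subseteq> H}"

text \<open>Outside the second countable case a left-invariant Borel probability measure need not be
  regular; regularity is part of the notion of Haar measure and makes it unique.\<close>

definition normalized_haar_measure ::
  "('a, 'b) monoid_scheme \<Rightarrow> 'a topology \<Rightarrow> 'a measure \<Rightarrow> bool" where
  "normalized_haar_measure G T M \<longleftrightarrow>
     space M = carrier G \<and>
     sets M = sigma_sets (carrier G) {U. openin T U} \<and>
     emeasure M (carrier G) = 1 \<and>
     (\<forall>g \<in> carrier G. \<forall>A \<in> sets M. emeasure M (g <#\<^bsub>G\<^esub> A) = emeasure M A) \<and>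
     (\<forall>A \<in> sets M. \<forall>e > 0. \<exists>C U. closedin T C \<and> openin T U \<and>
        C \<subseteq> A \<and> A \<subseteq> U \<and> emeasure M (U - C) < e)"

definition pro_p_partners ::
  "nat \<Rightarrow> ('a, 'b) monoid_scheme \<Rightarrow> 'a topology \<Rightarrow> 'a \<Rightarrow> 'a set" where
  "pro_p_partners p G T x =
     {g \<in> carrier G. pro_p_subgroup p G T (closed_subgroup_generated G T {g, x})}"

text \<open>The sets \<open>pro_p_partners p G T x\<close> are closed and \<open>pro_p_positive p G T M\<close> is Borel, so
  \<open>measure\<close>, which is 0 on non-measurable sets, gives their true Haar measure.\<close>

definition pro_p_positive ::
  "nat \<Rightarrow> ('a, 'b) monoid_scheme \<Rightarrow> 'a topology \<Rightarrow> 'a measure \<Rightarrow> 'a set" where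
  "pro_p_positive p G T M = {g \<in> carrier G. measure M (pro_p_partners p G T g) > 0}"

end

theory Submission
  imports Defs "HOL-Algebra.Left_Coset" "HOL-Algebra.Sylow"
begin

text \<open>
  Call an open subgroup \<open>P\<close> of index \<open>m\<close> prime to \<open>p\<close> a test subgroup, and let \<open>G\<close> act by left
  translation on the \<open>m\<close> left cosets of \<open>P\<close>. On this finite set a pro-\<open>p\<close> subgroup has orbits of
  \<open>p\<close>-power length, so, \<open>m\<close> being prime to \<open>p\<close>, it fixes some coset
  (\<open>pro_p_subgroup_fixes_lcoset\<close>). Hence if \<open>g\<close> and \<open>x\<close> generate a pro-\<open>p\<close> group, both lie in the
  stabilizer of a common coset. Each stabilizer is an open subgroup of index \<open>m\<close> and has measure
  \<open>1 / m\<close>.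

  Let \<open>u x\<close> be the number of cosets fixed by \<open>x\<close>. The partners of \<open>x\<close> are covered by \<open>u x\<close>
  stabilizers, so their measure is at most \<open>u x / m\<close>, while the integral of \<open>u\<close> is
  \<open>m * (1 / m) = 1\<close>. By Markov's inequality the elements whose partners have measure at least \<open>d\<close>
  lie in a set of measure at most \<open>1 / (m * d)\<close> (\<open>many_partners_small_measure\<close>). If \<open>m\<close> can be
  arbitrarily large, then for every \<open>d > 0\<close> these elements lie in a null set, and so do the elements
  whose partners have positive measure (\<open>pro_p_positive_null_if_unbounded_index\<close>).

  Under the hypothesis of the theorem the index of test subgroups is therefore bounded, and a test
  subgroup \<open>P\<close> of largest index exists. It is pro-\<open>p\<close>: if \<open>N\<close> is open and normal in \<open>P\<close>, the
  preimage in \<open>P\<close> of a Sylow \<open>p\<close>-subgroup of \<open>P / N\<close> is again a test subgroup, so by maximality it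
  is \<open>P\<close> itself (\<open>maximal_index_imp_pro_p_subgroup\<close>).
\<close>

section \<open>Left cosets and indices in possibly infinite groups\<close>

(* The multiset relation written in the same way would make every left coset ambiguous. *)
no_notation subset_mset (infix \<open><#\<close> 50)

text \<open>Left cosets are used because Haar measure is invariant under left translation.\<close>
definition subgroup_index :: "('a, 'b) monoid_scheme \<Rightarrow> 'a set \<Rightarrow> nat" where
  "subgroup_index G H = card (lcosets\<^bsub>G\<^esub> H)"

lemma lcosets_eq_image: "lcosets\<^bsub>G\<^esub> H = (\<lambda>x. x <#\<^bsub>G\<^esub> H) ` carrier G"
  by (auto simp: LCOSETS_def)

lemma lcosets_subgroup_carrier:
  "lcosets\<^bsub>G\<lparr>carrier := S\<rparr>\<^esub> K = (\<lambda>x. x <#\<^bsub>G\<^esub> K) ` S"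
  by (simp add: lcosets_eq_image)

lemma card_image_eq_if_same_fibres:
  assumes "\<And>x y. x \<in> A \<Longrightarrow> y \<in> A \<Longrightarrow> f x = f y \<longleftrightarrow> g x = g y"
  shows "card (f ` A) = card (g ` A)"
proof (rule bij_betw_same_card)
  show "bij_betw (\<lambda>b. g (inv_into A f b)) (f ` A) (g ` A)"
  proof (rule bij_betw_imageI)
    show "inj_on (\<lambda>b. g (inv_into A f b)) (f ` A)"
      by (smt (verit) assms f_inv_into_f inj_onI inv_into_into)
    show "(\<lambda>b. g (inv_into A f b)) ` f ` A = g ` A"
    proof -
      have "g (inv_into A f (f x)) = g x" if "x \<in> A" for x
        using assms[of "inv_into A f (f x)" x] that by (simp add: f_inv_into_f inv_into_into)
      then show ?thesis by (simp add: image_image)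
    qed
  qed
qed

context group
begin

lemma lcos_eq_iff:
  assumes "subgroup S G" "x \<in> carrier G" "y \<in> carrier G"
  shows "x <# S = y <# S \<longleftrightarrow> inv x \<otimes> y \<in> S"
proof
  assume "x <# S = y <# S"
  then have "y \<in> x <# S" using lcos_self[OF assms(3,1)] by simp
  then show "inv x \<otimes> y \<in> S"
    using subgroup.lcos_module_imp[OF assms(1) group_axioms assms(2)] by simp
next
  assume "inv x \<otimes> y \<in> S"
  then have "y \<in> x <# S"
    using subgroup.lcos_module_rev[OF assms(1) group_axioms assms(2,3)] by simp
  then show "x <# S = y <# S"
    using l_repr_independence assms by blast
qed

lemma lcosets_translate:
  assumes "S \<subseteq> carrier G" "g \<in> carrier G" "c \<in> lcosets S"
  shows "g <# c \<in> lcosets S"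
  using assms by (auto simp: lcosets_eq_image lcos_m_assoc)

lemma lcos_cancel:
  assumes "g \<in> carrier G" "A \<subseteq> carrier G" "B \<subseteq> carrier G" "g <# A = g <# B"
  shows "A = B"
proof -
  have "A = inv g <# (g <# A)" using assms(1,2) by (simp add: lcos_m_assoc lcos_mult_one)
  also have "\<dots> = inv g <# (g <# B)" by (simp only: assms(4))
  also have "\<dots> = B" using assms(1,3) by (simp add: lcos_m_assoc lcos_mult_one)
  finally show ?thesis .
qed

text \<open>The group may be infinite, so Lagrange's theorem for orders does not give this. If \<open>rep c\<close>
  represents the coset \<open>c\<close> of \<open>S\<close>, then \<open>(c, d) \<mapsto> rep c <# d\<close> is a bijection from pairs of a
  coset of \<open>S\<close> and a coset of \<open>K\<close> inside \<open>S\<close> to the cosets of \<open>K\<close>.\<close>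
lemma subgroup_index_mult:
  assumes S: "subgroup S G" and K: "subgroup K G" and KS: "K \<subseteq> S"
  shows "subgroup_index G K = subgroup_index G S * subgroup_index (G\<lparr>carrier := S\<rparr>) K"
proof -
  define rep where "rep c = (SOME x. x \<in> carrier G \<and> x <# S = c)" for c
  have rep: "rep c \<in> carrier G" "rep c <# S = c" if "c \<in> lcosets S" for c
  proof -
    have "\<exists>x. x \<in> carrier G \<and> x <# S = c" using that by (auto simp: lcosets_eq_image)
    then show "rep c \<in> carrier G" "rep c <# S = c"
      unfolding rep_def by (metis (mono_tags, lifting) someI_ex)+
  qed
  let ?D = "(\<lambda>x. x <# K) ` S"
  have SG: "S \<subseteq> carrier G" and KG: "K \<subseteq> carrier G" using S K by (auto dest: subgroup.subset)
  have DG: "d \<subseteq> S" "d \<noteq> {}" if "d \<in> ?D" for d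
    using that KS subgroup.m_closed[OF S] subgroup.one_closed[OF K]
    by (auto simp: l_coset_def)
  have inj: "inj_on (\<lambda>(c, d). rep c <# d) ((lcosets S) \<times> ?D)"
  proof (rule inj_onI, clarify)
    fix c x c' x'
    assume c: "c \<in> lcosets S" and c': "c' \<in> lcosets S" and x: "x \<in> S" and x': "x' \<in> S"
      and eq: "rep c <# (x <# K) = rep c' <# (x' <# K)"
    have 1: "rep c <# (x <# K) \<subseteq> c"
      using DG(1)[of "x <# K"] x rep(2)[OF c] by (auto simp: l_coset_def)
    have 2: "rep c' <# (x' <# K) \<subseteq> c'"
      using DG(1)[of "x' <# K"] x' rep(2)[OF c'] by (auto simp: l_coset_def)
    have 3: "rep c <# (x <# K) \<noteq> {}"
      using DG(2)[of "x <# K"] x by (auto simp: l_coset_def)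
    have cc: "c = c'" using lcos_disjoint[OF S c c'] 1 2 3 eq by blast
    then have "x <# K = x' <# K"
      using lcos_cancel[OF rep(1)[OF c], of "x <# K" "x' <# K"] eq DG(1) x x' SG
        l_coset_subset_G[OF KG] by (metis subsetD)
    then show "c = c' \<and> x <# K = x' <# K" using cc by simp
  qed
  have img: "(\<lambda>(c, d). rep c <# d) ` ((lcosets S) \<times> ?D) = lcosets K"
  proof (intro equalityI subsetI)
    fix e assume "e \<in> (\<lambda>(c, d). rep c <# d) ` ((lcosets S) \<times> ?D)"
    then show "e \<in> lcosets K"
      using rep SG KG by (auto simp: lcosets_eq_image lcos_m_assoc)
  next
    fix e assume "e \<in> lcosets K"
    then obtain x where x: "x \<in> carrier G" "e = x <# K" by (auto simp: lcosets_eq_image)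
    define c where "c = x <# S"
    have c: "c \<in> lcosets S" using x by (auto simp: c_def lcosets_eq_image)
    have s: "inv (rep c) \<otimes> x \<in> S"
      using rep[OF c] lcos_eq_iff[OF S rep(1)[OF c] x(1)] by (simp add: c_def)
    have "rep c <# ((inv (rep c) \<otimes> x) <# K) = e"
      using rep(1)[OF c] x KG by (simp add: lcos_m_assoc m_assoc[symmetric])
    then show "e \<in> (\<lambda>(c, d). rep c <# d) ` ((lcosets S) \<times> ?D)"
      using c s by (force intro!: image_eqI[where x = "(c, (inv (rep c) \<otimes> x) <# K)"])
  qed
  show ?thesis
    unfolding subgroup_index_def lcosets_subgroup_carrier
    using card_image[OF inj] img by (simp add: card_cartesian_product)
qed

lemma subgroup_stabilizer_of_lcoset:
  assumes S: "subgroup S G" and c: "c \<in> lcosets S"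
  shows "subgroup {g \<in> carrier G. g <# c = c} G"
proof -
  have cG: "c \<subseteq> carrier G" using S c by (rule subgroup.lcosets_carrier[OF _ group_axioms])
  show ?thesis
  proof (rule subgroupI)
    fix a assume "a \<in> {g \<in> carrier G. g <# c = c}"
    then have a: "a \<in> carrier G" "a <# c = c" by auto
    have "inv a <# c = inv a <# (a <# c)" by (simp only: a(2))
    also have "\<dots> = c" using a(1) cG by (simp add: lcos_m_assoc lcos_mult_one)
    finally show "inv a \<in> {g \<in> carrier G. g <# c = c}" using a by simp
  next
    show "a \<otimes> b \<in> {g \<in> carrier G. g <# c = c}"
      if "a \<in> {g \<in> carrier G. g <# c = c}" "b \<in> {g \<in> carrier G. g <# c = c}" for a b
      using that cG by (simp add: lcos_m_assoc[symmetric])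
  qed (use cG lcos_mult_one in auto)
qed

text \<open>The orbit-stabilizer theorem: \<open>x\<close> and \<open>y\<close> move \<open>c\<close> to the same place exactly when they lie in
  the same left coset of the stabilizer. Counting cosets and not group orders makes it usable for
  infinite \<open>H\<close>.\<close>
lemma card_orbit_of_lcoset:
  assumes S: "subgroup S G" and c: "c \<in> lcosets S" and H: "subgroup H G"
  shows "card ((\<lambda>h. h <# c) ` H) = subgroup_index (G\<lparr>carrier := H\<rparr>) {h \<in> H. h <# c = c}"
proof -
  let ?C = "{g \<in> carrier G. g <# c = c}"
  have cG: "c \<subseteq> carrier G" using S c by (rule subgroup.lcosets_carrier[OF _ group_axioms])
  have sub: "subgroup ?C G" using subgroup_stabilizer_of_lcoset[OF S c] .
  have HG: "H \<subseteq> carrier G" using H by (rule subgroup.subset)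
  have eq: "{h \<in> H. h <# c = c} = ?C \<inter> H" using HG by auto
  have sub': "subgroup (?C \<inter> H) G" using subgroups_Inter_pair[OF sub H] .
  have "x <# c = y <# c \<longleftrightarrow> x <# (?C \<inter> H) = y <# (?C \<inter> H)" if "x \<in> H" "y \<in> H" for x y
  proof -
    have xy: "x \<in> carrier G" "y \<in> carrier G" using that HG by auto
    have "x <# c = y <# c \<longleftrightarrow> (inv x \<otimes> y) <# c = c"
    proof
      assume e: "x <# c = y <# c"
      have "(inv x \<otimes> y) <# c = inv x <# (x <# c)"
        unfolding e using xy cG by (simp add: lcos_m_assoc)
      then show "(inv x \<otimes> y) <# c = c" using xy cG by (simp add: lcos_m_assoc lcos_mult_one)
    next
      assume e: "(inv x \<otimes> y) <# c = c"
      have "x <# ((inv x \<otimes> y) <# c) = y <# c"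
        using xy cG by (simp add: lcos_m_assoc m_assoc[symmetric])
      then show "x <# c = y <# c" using e by simp
    qed
    also have "\<dots> \<longleftrightarrow> inv x \<otimes> y \<in> ?C \<inter> H"
      using that xy subgroup.m_closed[OF H] subgroup.m_inv_closed[OF H] by auto
    also have "\<dots> \<longleftrightarrow> x <# (?C \<inter> H) = y <# (?C \<inter> H)"
      using lcos_eq_iff[OF sub' xy] by simp
    finally show ?thesis .
  qed
  then show ?thesis
    unfolding eq subgroup_index_def lcosets_subgroup_carrier
    by (rule card_image_eq_if_same_fibres)
qed

lemma lcosets_transitive:
  assumes S: "subgroup S G" and c: "c \<in> lcosets S"
  shows "(\<lambda>h. h <# c) ` carrier G = lcosets S"
proof -
  have SG: "S \<subseteq> carrier G" using S by (rule subgroup.subset)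
  obtain x where x: "x \<in> carrier G" "c = x <# S" using c by (auto simp: lcosets_eq_image)
  have "y <# S \<in> (\<lambda>h. h <# c) ` carrier G" if y: "y \<in> carrier G" for y
    by (rule image_eqI[where x = "y \<otimes> inv x"]) (use x y SG in \<open>auto simp: lcos_m_assoc m_assoc\<close>)
  then show ?thesis using lcosets_translate[OF SG _ c] by (auto simp: lcosets_eq_image[of G S])
qed

lemma index_stabilizer_of_lcoset:
  assumes S: "subgroup S G" and c: "c \<in> lcosets S"
  shows "subgroup_index G {g \<in> carrier G. g <# c = c} = subgroup_index G S"
  using card_orbit_of_lcoset[OF S c subgroup_self] lcosets_transitive[OF S c]
  by (simp add: subgroup_index_def)

text \<open>A subgroup \<open>H\<close> that acts on the cosets of \<open>P\<close> through a finite \<open>p\<close>-group has orbits whose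
  length is a power of \<open>p\<close>. Without a fixed coset, \<open>p\<close> would divide the length of every orbit and
  hence the number of cosets. The subgroup \<open>K\<close> of elements acting trivially serves to express that
  the action factors through a group of \<open>p\<close>-power order.\<close>
lemma p_action_has_fixed_lcoset:
  assumes p: "prime p" and P: "subgroup P G" and fin: "finite (lcosets P)"
    and pP: "\<not> p dvd subgroup_index G P"
    and H: "subgroup H G" and K: "subgroup K G" "K \<subseteq> H"
    and Ktriv: "\<And>k c. k \<in> K \<Longrightarrow> c \<in> lcosets P \<Longrightarrow> k <# c = c"
    and ind: "subgroup_index (G\<lparr>carrier := H\<rparr>) K = p ^ n"
  shows "\<exists>c \<in> lcosets P. \<forall>h \<in> H. h <# c = c"
proof (rule ccontr)
  assume neg: "\<not> ?thesis"
  let ?orb = "\<lambda>c. (\<lambda>h. h <# c) ` H"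
  have PG: "P \<subseteq> carrier G" and HG: "H \<subseteq> carrier G" using P H by (auto dest: subgroup.subset)
  have cG: "c \<subseteq> carrier G" if "c \<in> lcosets P" for c
    using P that by (rule subgroup.lcosets_carrier[OF _ group_axioms])
  have refl: "c \<in> ?orb c" if "c \<in> lcosets P" for c
    using lcos_mult_one[OF cG[OF that]] subgroup.one_closed[OF H]
    by (metis (no_types, lifting) image_eqI)
  have un: "\<Union>(?orb ` (lcosets P)) = lcosets P"
  proof (rule equalityI)
    show "\<Union>(?orb ` (lcosets P)) \<subseteq> lcosets P"
      using lcosets_translate[OF PG] subsetD[OF HG] by auto
    show "lcosets P \<subseteq> \<Union>(?orb ` (lcosets P))" using refl by (meson UN_I subsetI)
  qed
  have dv: "p dvd card (?orb c)" if c: "c \<in> lcosets P" for c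
  proof -
    let ?C = "{h \<in> H. h <# c = c}"
    have "?C = {g \<in> carrier G. g <# c = c} \<inter> H" using HG by auto
    then have sub: "subgroup ?C G"
      using subgroups_Inter_pair[OF subgroup_stabilizer_of_lcoset[OF P c] H] by simp
    interpret H: group "G\<lparr>carrier := H\<rparr>" using subgroup.subgroup_is_group[OF H group_axioms] .
    have "subgroup ?C (G\<lparr>carrier := H\<rparr>)" using subgroup_incl[OF sub H] by auto
    moreover have "subgroup K (G\<lparr>carrier := H\<rparr>)" using subgroup_incl[OF K(1) H] K(2) by auto
    moreover have KC: "K \<subseteq> ?C" using K(2) Ktriv[OF _ c] by blast
    ultimately have "subgroup_index (G\<lparr>carrier := H\<rparr>) ?C dvd p ^ n"
      using H.subgroup_index_mult[of ?C K] by (simp add: ind[symmetric])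
    then have "card (?orb c) dvd p ^ n" using card_orbit_of_lcoset[OF P c H] by simp
    then obtain i where i: "card (?orb c) = p ^ i"
      using divides_primepow_nat[OF p] by blast
    have "card (?orb c) \<noteq> 1"
    proof
      assume "card (?orb c) = 1"
      then obtain d where d: "?orb c = {d}" by (rule card_1_singletonE)
      then have "d = c" using refl[OF c] by simp
      have "h <# c = c" if "h \<in> H" for h
        using imageI[OF that, of "\<lambda>h. h <# c"] unfolding d \<open>d = c\<close> by simp
      then show False using neg c by (meson bexI)
    qed
    then show ?thesis using i by (cases i) auto
  qed
  have dj: "?orb c = ?orb c'" if "c \<in> lcosets P" "c' \<in> lcosets P" "?orb c \<inter> ?orb c' \<noteq> {}" for c c'
  proof -
    have *: "?orb (h <# c) = ?orb c" if "c \<in> lcosets P" "h \<in> H" for c h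
    proof -
      have hG: "h \<in> carrier G" using that HG by auto
      have "k <# c \<in> ?orb (h <# c)" if k: "k \<in> H" for k
      proof (rule image_eqI[where x = "k \<otimes> inv h"])
        have "k \<in> carrier G" using k HG by auto
        then show "k <# c = (k \<otimes> inv h) <# (h <# c)"
          using hG cG[OF \<open>c \<in> lcosets P\<close>] by (simp add: lcos_m_assoc m_assoc)
        show "k \<otimes> inv h \<in> H"
          using k \<open>h \<in> H\<close> subgroup.m_closed[OF H] subgroup.m_inv_closed[OF H] by blast
      qed
      moreover have "k <# (h <# c) \<in> ?orb c" if k: "k \<in> H" for k
      proof (rule image_eqI[where x = "k \<otimes> h"])
        have "k \<in> carrier G" using k HG by auto
        then show "k <# (h <# c) = (k \<otimes> h) <# c"
          using hG cG[OF \<open>c \<in> lcosets P\<close>] by (simp add: lcos_m_assoc)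
        show "k \<otimes> h \<in> H" using k \<open>h \<in> H\<close> subgroup.m_closed[OF H] by blast
      qed
      ultimately show ?thesis by (intro equalityI image_subsetI)
    qed
    from that(3) obtain h h' where "h \<in> H" "h' \<in> H" "h <# c = h' <# c'"
      by (auto simp: disjoint_iff)
    then show ?thesis using *[OF that(1), of h] *[OF that(2), of h'] by simp
  qed
  have "p dvd card (\<Union>(?orb ` (lcosets P)))"
  proof (rule dvd_partition)
    show "\<forall>c1 \<in> ?orb ` (lcosets P). \<forall>c2 \<in> ?orb ` (lcosets P). c1 \<noteq> c2 \<longrightarrow> c1 \<inter> c2 = {}"
    proof (intro ballI impI)
      fix o1 o2
      assume o1: "o1 \<in> ?orb ` (lcosets P)" and o2: "o2 \<in> ?orb ` (lcosets P)" and ne: "o1 \<noteq> o2"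
      obtain c1 where c1: "o1 = ?orb c1" "c1 \<in> lcosets P" using o1 by (rule imageE)
      obtain c2 where c2: "o2 = ?orb c2" "c2 \<in> lcosets P" using o2 by (rule imageE)
      show "o1 \<inter> o2 = {}" using dj[OF c1(2) c2(2)] ne unfolding c1(1) c2(1) by argo
    qed
  qed (use un fin dv in auto)
  then show False using pP un by (simp add: subgroup_index_def)
qed

lemma order_Mod_eq_subgroup_index:
  assumes "K \<lhd> G"
  shows "order (G Mod K) = subgroup_index G K"
  using normal.coset_eq[OF assms]
  by (auto simp: order_def FactGroup_def RCOSETS_def LCOSETS_def subgroup_index_def)

text \<open>Here \<open>Q\<close> is the preimage of a Sylow \<open>p\<close>-subgroup of the finite group \<open>G Mod K\<close>.\<close>
lemma sylow_above_normal:
  assumes p: "prime p" and K: "K \<lhd> G" and fin: "finite (lcosets K)"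
  obtains Q n where "subgroup Q G" "K \<subseteq> Q" "\<not> p dvd subgroup_index G Q"
    "subgroup_index (G\<lparr>carrier := Q\<rparr>) K = p ^ n"
proof -
  interpret K: normal K G by fact
  have rl: "rcosets K = lcosets K"
    using K.coset_eq by (auto simp: RCOSETS_def LCOSETS_def)
  have FG: "group (G Mod K)" by (rule K.factorgroup_is_group)
  have carr: "carrier (G Mod K) = lcosets K" by (simp add: FactGroup_def rl)
  have pos: "order (G Mod K) \<noteq> 0"
    using fin group.one_in_subset carr
    by (metis FG group.is_monoid monoid.order_gt_0_iff_finite not_gr0)
  obtain b where b: "order (G Mod K) = p ^ multiplicity p (order (G Mod K)) * b" "\<not> p dvd b"
    using multiplicity_decompose'[OF pos] p by (metis not_prime_unit)
  define n where "n = multiplicity p (order (G Mod K))"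
  obtain A where A: "subgroup A (G Mod K)" "card A = p ^ n"
    using sylow_thm[OF p FG b(1)] fin carr n_def by auto
  define Q where "Q = \<Union>A"
  have Q: "subgroup Q G" unfolding Q_def by (rule K.factgroup_subgroup_union_subgroup[OF A(1)])
  have KA: "K \<in> A" using subgroup.one_closed[OF A(1)] by simp
  have KQ: "K \<subseteq> Q" using KA by (auto simp: Q_def)
  have "A = lcosets\<^bsub>G\<lparr>carrier := Q\<rparr>\<^esub> K"
    using K.factgroup_subgroup_union_factor[OF A(1)] K.coset_eq subgroup.subset[OF Q]
    unfolding Q_def[symmetric] by (auto simp: RCOSETS_def LCOSETS_def subset_iff)
  then have i: "subgroup_index (G\<lparr>carrier := Q\<rparr>) K = p ^ n" using A(2) by (simp add: subgroup_index_def)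
  have "p ^ n * b = subgroup_index G Q * p ^ n"
    using subgroup_index_mult[OF Q K.subgroup_axioms KQ] i b(1) order_Mod_eq_subgroup_index[OF K]
    unfolding n_def by metis
  then have "b = subgroup_index G Q" using p by (simp add: prime_gt_0_nat)
  then show ?thesis using that Q KQ b(2) i by blast
qed

end

section \<open>Open subgroups of compact and profinite groups\<close>

context
  fixes G :: "('a, 'b) monoid_scheme" (structure) and T :: "'a topology"
begin

lemma continuous_map_two_sided_translation:
  assumes tg: "topological_group G T" and a: "a \<in> carrier G" and b: "b \<in> carrier G"
  shows "continuous_map T T (\<lambda>x. a \<otimes> x \<otimes> b)"
proof -
  have top: "topspace T = carrier G"
    and m: "continuous_map (prod_topology T T) T (\<lambda>(x, y). x \<otimes> y)"
    using tg by (auto simp: topological_group_def)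
  have "continuous_map T (prod_topology T T) (\<lambda>x. (a, x))"
    using a top by (intro continuous_map_pairedI) auto
  from continuous_map_compose[OF this m] have 1: "continuous_map T T (\<lambda>x. a \<otimes> x)"
    by (simp add: o_def)
  have "continuous_map T (prod_topology T T) (\<lambda>x. (a \<otimes> x, b))"
    using b top 1 by (intro continuous_map_pairedI) auto
  from continuous_map_compose[OF this m] show ?thesis by (simp add: o_def)
qed

lemma openin_lcos:
  assumes tg: "topological_group G T" and U: "openin T U" and g: "g \<in> carrier G"
  shows "openin T (g <# U)"
proof -
  interpret group G using tg by (simp add: topological_group_def)
  have top: "topspace T = carrier G" using tg by (simp add: topological_group_def)
  have UG: "U \<subseteq> carrier G" using openin_subset[OF U] top by simp
  have "openin T {x \<in> topspace T. inv g \<otimes> x \<otimes> \<one> \<in> U}"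
    by (rule openin_continuous_map_preimage[OF continuous_map_two_sided_translation[OF tg] U])
      (use g in auto)
  also have "{x \<in> topspace T. inv g \<otimes> x \<otimes> \<one> \<in> U} = g <# U"
  proof (intro equalityI subsetI)
    fix x assume "x \<in> {x \<in> topspace T. inv g \<otimes> x \<otimes> \<one> \<in> U}"
    then have x: "x \<in> carrier G" "inv g \<otimes> x \<in> U" using g top by auto
    have "x = g \<otimes> (inv g \<otimes> x)" using x(1) g by (simp add: m_assoc[symmetric])
    then show "x \<in> g <# U" using x(2) by (auto simp: l_coset_def)
  next
    fix x assume "x \<in> g <# U"
    then obtain u where u: "u \<in> U" "x = g \<otimes> u" by (auto simp: l_coset_def)
    then have "inv g \<otimes> x = u" using g UG by (simp add: m_assoc[symmetric] subset_iff)
    then show "x \<in> {x \<in> topspace T. inv g \<otimes> x \<otimes> \<one> \<in> U}" using u g UG top by auto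
  qed
  finally show ?thesis .
qed

lemma openin_subgroup_mono:
  assumes tg: "topological_group G T" and K: "subgroup K G" "openin T K"
    and S: "subgroup S G" and KS: "K \<subseteq> S"
  shows "openin T S"
proof -
  interpret group G using tg by (simp add: topological_group_def)
  have "S = (\<Union>s\<in>S. s <# K)"
  proof (intro equalityI subsetI)
    fix s assume "s \<in> S"
    then show "s \<in> (\<Union>s\<in>S. s <# K)"
      using lcos_self[OF _ K(1)] subgroup.mem_carrier[OF S] by blast
  next
    fix x assume "x \<in> (\<Union>s\<in>S. s <# K)"
    then show "x \<in> S" using subgroup.m_closed[OF S] KS by (auto simp: l_coset_def)
  qed
  also have "openin T \<dots>"
    using openin_lcos[OF tg K(2)] subgroup.subset[OF S] by (intro openin_Union) auto
  finally show ?thesis .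
qed

lemma closedin_open_subgroup:
  assumes tg: "topological_group G T" and S: "subgroup S G" "openin T S"
  shows "closedin T S"
proof -
  interpret group G using tg by (simp add: topological_group_def)
  have top: "topspace T = carrier G" using tg by (simp add: topological_group_def)
  have "carrier G - S = (\<Union>x\<in>carrier G - S. x <# S)"
  proof (intro equalityI subsetI)
    fix x assume "x \<in> carrier G - S"
    then show "x \<in> (\<Union>x\<in>carrier G - S. x <# S)" using lcos_self[OF _ S(1)] by blast
  next
    fix y assume "y \<in> (\<Union>x\<in>carrier G - S. x <# S)"
    then obtain x s where x: "x \<in> carrier G" "x \<notin> S" and s: "s \<in> S" "y = x \<otimes> s"
      by (auto simp: l_coset_def)
    have sG: "s \<in> carrier G" using s subgroup.subset[OF S(1)] by auto
    (* If y were in S, so would be x. *)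
    have "x = y \<otimes> inv s" using x sG s by (simp add: m_assoc)
    then have "y \<notin> S"
      using x(2) subgroup.m_closed[OF S(1)] subgroup.m_inv_closed[OF S(1) s(1)] by metis
    then show "y \<in> carrier G - S" using x sG s by simp
  qed
  then have "openin T (carrier G - S)"
    using openin_lcos[OF tg S(2)] by (metis (no_types, lifting) DiffD1 imageE openin_Union)
  then show ?thesis using top subgroup.subset[OF S(1)] by (simp add: closedin_def)
qed

text \<open>The cosets are a disjoint open cover, so a finite subcover contains all of them.\<close>
lemma finite_lcosets_open_subgroup:
  assumes tg: "topological_group G T" and comp: "compact_space T"
    and S: "subgroup S G" "openin T S"
  shows "finite (lcosets S)"
proof -
  interpret group G using tg by (simp add: topological_group_def)
  have top: "topspace T = carrier G" using tg by (simp add: topological_group_def)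
  have "\<forall>U \<in> lcosets S. openin T U"
    using openin_lcos[OF tg S(2)] by (auto simp: lcosets_eq_image)
  then obtain F where F: "finite F" "F \<subseteq> lcosets S" "carrier G \<subseteq> \<Union>F"
    using comp lcosets_part_G[OF S(1)] unfolding compact_space_alt top
    by (metis order_refl)
  have "c \<in> F" if c: "c \<in> lcosets S" for c
  proof -
    obtain x where x: "x \<in> carrier G" "c = x <# S" using c by (auto simp: lcosets_eq_image)
    then have "x \<in> c" using lcos_self[OF _ S(1)] by simp
    moreover obtain d where "d \<in> F" "x \<in> d" using F(3) x(1) by auto
    ultimately show ?thesis using lcos_disjoint[OF S(1) c, of d] F(2) by blast
  qed
  then show ?thesis by (intro finite_subset[OF _ F(1)] subsetI)
qed

text \<open>The stabilizer of \<open>x <# S\<close> is the conjugate of \<open>S\<close> by \<open>x\<close>, a preimage of \<open>S\<close> under a continuous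
  map.\<close>
lemma openin_stabilizer_of_lcoset:
  assumes tg: "topological_group G T" and S: "subgroup S G" "openin T S"
    and c: "c \<in> lcosets S"
  shows "openin T {g \<in> carrier G. g <# c = c}"
proof -
  interpret group G using tg by (simp add: topological_group_def)
  have top: "topspace T = carrier G" using tg by (simp add: topological_group_def)
  obtain x where x: "x \<in> carrier G" "c = x <# S" using c by (auto simp: lcosets_eq_image)
  have "g <# c = c \<longleftrightarrow> inv x \<otimes> g \<otimes> x \<in> S" if g: "g \<in> carrier G" for g
  proof -
    have "g <# c = c \<longleftrightarrow> x <# S = (g \<otimes> x) <# S"
      using g x subgroup.subset[OF S(1)] by (auto simp: lcos_m_assoc)
    also have "\<dots> \<longleftrightarrow> inv x \<otimes> g \<otimes> x \<in> S"
      using lcos_eq_iff[OF S(1) x(1), of "g \<otimes> x"] g x by (simp add: m_assoc)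
    finally show ?thesis .
  qed
  then have "{g \<in> carrier G. g <# c = c} = {g \<in> topspace T. inv x \<otimes> g \<otimes> x \<in> S}"
    using top by auto
  then show ?thesis
    using openin_continuous_map_preimage[OF continuous_map_two_sided_translation[OF tg] S(2)] x(1)
    by simp
qed

lemma profinite_open_subgroup:
  assumes pf: "profinite_group G T" and S: "subgroup S G" "openin T S"
  shows "profinite_group (G\<lparr>carrier := S\<rparr>) (subtopology T S)"
proof -
  have tg: "topological_group G T" and comp: "compact_space T" and haus: "Hausdorff_space T"
    and td: "totally_disconnected T" using pf by (auto simp: profinite_group_def)
  interpret group G using tg by (simp add: topological_group_def)
  have top: "topspace T = carrier G"
    and m: "continuous_map (prod_topology T T) T (\<lambda>(x, y). x \<otimes> y)"
    and i: "continuous_map T T (\<lambda>x. inv x)"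
    using tg by (auto simp: topological_group_def)
  have SG: "S \<subseteq> carrier G" using S(1) by (rule subgroup.subset)
  have topS: "topspace (subtopology T S) = S" using SG top by (simp add: inf.absorb2)
  have "continuous_map (subtopology (prod_topology T T) (S \<times> S)) (subtopology T S)
      (\<lambda>(x, y). x \<otimes> y)"
    using continuous_map_from_subtopology[OF m] subgroup.m_closed[OF S(1)]
    by (auto simp: continuous_map_in_subtopology)
  then have 1: "continuous_map (prod_topology (subtopology T S) (subtopology T S))
      (subtopology T S) (\<lambda>(x, y). x \<otimes> y)"
    by (simp add: subtopology_Times)
  have "continuous_map (subtopology T S) (subtopology T S) (\<lambda>x. inv x)"
    using continuous_map_from_subtopology[OF i] subgroup.m_inv_closed[OF S(1)] topS
    by (auto simp: continuous_map_in_subtopology)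
  then have 2: "continuous_map (subtopology T S) (subtopology T S)
      (\<lambda>x. inv\<^bsub>G\<lparr>carrier := S\<rparr>\<^esub> x)"
    by (rule continuous_map_eq) (use topS m_inv_consistent[OF S(1)] in auto)
  have tgS: "topological_group (G\<lparr>carrier := S\<rparr>) (subtopology T S)"
    using 1 2 topS subgroup.subgroup_is_group[OF S(1) group_axioms]
    by (simp add: topological_group_def)
  have compS: "compact_space (subtopology T S)"
    by (intro compact_space_subtopology closedin_compact_space comp closedin_open_subgroup[OF tg S])
  have "totally_disconnected (subtopology T S)"
    unfolding totally_disconnected_def topS
  proof (intro ballI equalityI subsetI)
    fix x y assume x: "x \<in> S" and "y \<in> connected_component_of_set (subtopology T S) x"
    then have "y \<in> connected_component_of_set T x"
      by (auto simp: connected_component_of_def connectedin_subtopology)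
    then show "y \<in> {x}" using td x SG top by (auto simp: totally_disconnected_def)
  next
    fix x y assume "x \<in> S" "y \<in> {x}"
    then show "y \<in> connected_component_of_set (subtopology T S) x"
      using topS by (simp add: connected_component_of_refl)
  qed
  then show ?thesis
    using tgS compS Hausdorff_space_subtopology[OF haus] by (simp add: profinite_group_def)
qed

text \<open>The elements of \<open>H\<close> that fix every coset of \<open>P\<close> form the kernel of the action. It is open,
  being cut out by finitely many open stabilizers, and normal in \<open>H\<close>; since \<open>H\<close> is pro-\<open>p\<close>, it
  acts through a finite \<open>p\<close>-group.\<close>
lemma pro_p_subgroup_fixes_lcoset:
  assumes p: "prime p" and pf: "profinite_group G T"
    and P: "subgroup P G" "openin T P" and pP: "\<not> p dvd subgroup_index G P"
    and H: "pro_p_subgroup p G T H"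
  shows "\<exists>c \<in> lcosets P. \<forall>h \<in> H. h <# c = c"
proof -
  have tg: "topological_group G T" and comp: "compact_space T"
    using pf by (auto simp: profinite_group_def)
  interpret group G using tg by (simp add: topological_group_def)
  have top: "topspace T = carrier G" using tg by (simp add: topological_group_def)
  have Hs: "subgroup H G" and Hp: "pro_p_group p (G\<lparr>carrier := H\<rparr>) (subtopology T H)"
    using H by (auto simp: pro_p_subgroup_def)
  have HG: "H \<subseteq> carrier G" using Hs by (rule subgroup.subset)
  interpret H: group "G\<lparr>carrier := H\<rparr>" using subgroup.subgroup_is_group[OF Hs group_axioms] .
  let ?L = "lcosets P"
  have fin: "finite ?L" using finite_lcosets_open_subgroup[OF tg comp P] .
  have cG: "c \<subseteq> carrier G" if "c \<in> ?L" for c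
    using P(1) that by (rule subgroup.lcosets_carrier[OF _ group_axioms])
  define C where "C c = {g \<in> carrier G. g <# c = c}" for c
  have Csub: "subgroup (C c) G" if "c \<in> ?L" for c
    unfolding C_def by (rule subgroup_stabilizer_of_lcoset[OF P(1) that])
  define K where "K = H \<inter> (\<Inter>c\<in>?L. C c)"
  have "?L \<noteq> {}" using one_closed by (auto simp: lcosets_eq_image)
  then have "subgroup (\<Inter>c\<in>?L. C c) G" using Csub by (intro subgroups_Inter) auto
  then have Ks: "subgroup K G" unfolding K_def using subgroups_Inter_pair[OF Hs] by blast
  have KH: "K \<subseteq> H" by (simp add: K_def)
  have Kfix: "k <# c = c" if "k \<in> K" "c \<in> ?L" for k c
    using that by (auto simp: K_def C_def)
  have KsH: "subgroup K (G\<lparr>carrier := H\<rparr>)" using subgroup_incl[OF Ks Hs KH] .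
  have "openin T (\<Inter>c\<in>?L. C c)"
    using fin \<open>?L \<noteq> {}\<close> openin_stabilizer_of_lcoset[OF tg P] unfolding C_def
    by (intro openin_Inter) auto
  then have Ko: "openin (subtopology T H) K"
    unfolding K_def by (metis inf_commute openin_subtopology_Int)
  have "K \<lhd> G\<lparr>carrier := H\<rparr>"
    unfolding H.normal_inv_iff
  proof (intro conjI KsH ballI)
    fix x k assume "x \<in> carrier (G\<lparr>carrier := H\<rparr>)" and k: "k \<in> K"
    then have x: "x \<in> H" by simp
    have xG: "x \<in> carrier G" and kG: "k \<in> carrier G" using x k HG KH by auto
    have "(x \<otimes> k \<otimes> inv x) <# c = c" if c: "c \<in> ?L" for c
    proof -
      have c': "inv x <# c \<in> ?L"
        using lcosets_translate[OF subgroup.subset[OF P(1)] _ c] xG by simp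
      have "(x \<otimes> k \<otimes> inv x) <# c = x <# (k <# (inv x <# c))"
        using xG kG cG[OF c] by (simp add: lcos_m_assoc m_assoc)
      also have "\<dots> = x <# (inv x <# c)" by (simp only: Kfix[OF k c'])
      also have "\<dots> = c" using xG cG[OF c] by (simp add: lcos_m_assoc lcos_mult_one)
      finally show ?thesis .
    qed
    moreover have "x \<otimes> k \<otimes> inv x \<in> H"
      using x k KH subgroup.m_closed[OF Hs] subgroup.m_inv_closed[OF Hs] by blast
    ultimately have "x \<otimes> k \<otimes> inv x \<in> K" using HG by (auto simp: K_def C_def)
    then show "x \<otimes>\<^bsub>G\<lparr>carrier := H\<rparr>\<^esub> k \<otimes>\<^bsub>G\<lparr>carrier := H\<rparr>\<^esub> inv\<^bsub>G\<lparr>carrier := H\<rparr>\<^esub> x \<in> K"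
      using m_inv_consistent[OF Hs x] by simp
  qed
  then obtain n where "subgroup_index (G\<lparr>carrier := H\<rparr>) K = p ^ n"
    using Hp Ko H.order_Mod_eq_subgroup_index unfolding pro_p_group_def finite_p_group_def by metis
  then show ?thesis
    using p_action_has_fixed_lcoset[OF p P(1) fin pP Hs Ks KH Kfix] by blast
qed

section \<open>Counting fixed cosets and Markov's inequality\<close>

lemma measure_open_subgroup:
  assumes tg: "topological_group G T" and comp: "compact_space T"
    and haar: "normalized_haar_measure G T M" and S: "subgroup S G" "openin T S"
  shows "measure M S * real (subgroup_index G S) = 1"
proof -
  interpret group G using tg by (simp add: topological_group_def)
  have spM: "space M = carrier G" and M1: "emeasure M (carrier G) = 1"
    and setsM: "sets M = sigma_sets (carrier G) {U. openin T U}"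
    and inv: "\<And>g A. g \<in> carrier G \<Longrightarrow> A \<in> sets M \<Longrightarrow> emeasure M (g <# A) = emeasure M A"
    using haar by (auto simp: normalized_haar_measure_def)
  interpret finite_measure M by (rule finite_measureI) (simp add: spM M1)
  have openM: "U \<in> sets M" if "openin T U" for U using that setsM by auto
  have L: "c \<in> sets M \<and> measure M c = measure M S" if "c \<in> lcosets S" for c
    using that openM openin_lcos[OF tg S(2)] inv[OF _ openM[OF S(2)]]
    by (auto simp: lcosets_eq_image measure_def)
  have "1 = measure M (\<Union>c\<in>lcosets S. c)"
    using lcosets_part_G[OF S(1)] M1 by (simp add: measure_def)
  also have "\<dots> = (\<Sum>c\<in>lcosets S. measure M c)"
    using L lcos_disjoint[OF S(1)] finite_lcosets_open_subgroup[OF tg comp S]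
    by (intro finite_measure_finite_Union) (auto simp: disjoint_family_on_def)
  also have "\<dots> = measure M S * real (subgroup_index G S)"
    using L by (simp add: subgroup_index_def)
  finally show ?thesis by simp
qed

text \<open>The function \<open>u\<close> counts the cosets of \<open>P\<close> fixed by an element. Its mean is 1, and the partners
  of \<open>x\<close> lie in the union of the \<open>u x\<close> stabilizers that contain \<open>x\<close>, each of measure \<open>1 / m\<close>, where
  \<open>m\<close> is the index of \<open>P\<close>. Partner measure at least \<open>d\<close> thus forces \<open>u x\<close> to be at least \<open>m * d\<close>.
  The set of these \<open>x\<close> is bounded through a measurable cover \<open>D\<close>, because \<open>measure\<close> would give 0
  for a non-measurable set.\<close>
lemma many_partners_small_measure:
  assumes p: "prime p" and pf: "profinite_group G T"
    and haar: "normalized_haar_measure G T M"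
    and P: "subgroup P G" "openin T P" and pP: "\<not> p dvd subgroup_index G P"
    and d: "d > 0"
  obtains D where "D \<in> sets M" "measure M D \<le> 1 / (real (subgroup_index G P) * d)"
    "{x \<in> carrier G. d \<le> measure M (pro_p_partners p G T x)} \<subseteq> D"
proof -
  have tg: "topological_group G T" and comp: "compact_space T"
    using pf by (auto simp: profinite_group_def)
  interpret group G using tg by (simp add: topological_group_def)
  have spM: "space M = carrier G" and M1: "emeasure M (carrier G) = 1"
    and setsM: "sets M = sigma_sets (carrier G) {U. openin T U}"
    using haar by (auto simp: normalized_haar_measure_def)
  interpret finite_measure M by (rule finite_measureI) (simp add: spM M1)
  let ?L = "lcosets P" and ?m = "real (subgroup_index G P)"
  define C where "C c = {g \<in> carrier G. g <# c = c}" for c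
  have fin: "finite ?L" using finite_lcosets_open_subgroup[OF tg comp P] .
  have mpos: "?m > 0" using measure_open_subgroup[OF tg comp haar P] by (cases "?m = 0") auto
  have Co: "openin T (C c)" if "c \<in> ?L" for c
    unfolding C_def by (rule openin_stabilizer_of_lcoset[OF tg P that])
  have CM: "C c \<in> sets M" if "c \<in> ?L" for c using Co[OF that] setsM by auto
  have mC: "measure M (C c) = 1 / ?m" if "c \<in> ?L" for c
    using measure_open_subgroup[OF tg comp haar subgroup_stabilizer_of_lcoset[OF P(1) that]]
      Co[OF that] index_stabilizer_of_lcoset[OF P(1) that] mpos
    by (simp add: C_def field_simps)
  define u where "u x = (\<Sum>c\<in>?L. indicat_real (C c) x)" for x
  define D where "D = {x \<in> space M. ?m * d \<le> u x}"
  have int: "integrable M u"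
    unfolding u_def using CM by (intro Bochner_Integration.integrable_sum) (simp add: less_top[symmetric])
  have "(\<integral>x. u x \<partial>M) = (\<Sum>c\<in>?L. measure M (C c))"
    unfolding u_def using CM sets.sets_into_space
    by (subst Bochner_Integration.integral_sum)
      (auto simp: less_top[symmetric] Int_absorb2 intro!: sum.cong)
  also have "\<dots> = 1" using mC mpos by (simp add: subgroup_index_def)
  finally have iu: "(\<integral>x. u x \<partial>M) = 1" .
  have "measure M D \<le> (\<integral>x. u x \<partial>M) / (?m * d)"
    unfolding D_def
    by (rule integral_Markov_inequality_measure[OF int sets.empty_sets])
      (use mpos d in \<open>auto simp: u_def intro!: sum_nonneg\<close>)
  then have mD: "measure M D \<le> 1 / (?m * d)" by (simp add: iu)
  have D: "D \<in> sets M" unfolding D_def using int by measurable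
  have "x \<in> D" if x: "x \<in> carrier G" and dx: "d \<le> measure M (pro_p_partners p G T x)" for x
  proof -
    let ?F = "{c \<in> ?L. x \<in> C c}"
    have sub: "pro_p_partners p G T x \<subseteq> (\<Union>c\<in>?F. C c)"
    proof
      fix g assume "g \<in> pro_p_partners p G T x"
      then have g: "g \<in> carrier G" "pro_p_subgroup p G T (closed_subgroup_generated G T {g, x})"
        by (auto simp: pro_p_partners_def)
      have "{g, x} \<subseteq> closed_subgroup_generated G T {g, x}"
        by (auto simp: closed_subgroup_generated_def)
      moreover obtain c where "c \<in> ?L" "\<forall>h \<in> closed_subgroup_generated G T {g, x}. h <# c = c"
        using pro_p_subgroup_fixes_lcoset[OF p pf P pP g(2)] by blast
      ultimately show "g \<in> (\<Union>c\<in>?F. C c)" using g x by (auto simp: C_def)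
    qed
    have "(\<Union>c\<in>?F. C c) \<in> sets M" using fin CM by (intro sets.finite_UN) auto
    from dx finite_measure_mono[OF sub this] have "d \<le> measure M (\<Union>c\<in>?F. C c)" by linarith
    also have "\<dots> \<le> (\<Sum>c\<in>?F. measure M (C c))"
      using fin CM by (intro finite_measure_subadditive_finite) auto
    also have "\<dots> = real (card ?F) / ?m" using mC by simp
    also have "real (card ?F) = u x"
      using fin unfolding u_def indicator_def by (simp add: sum.If_cases Collect_conj_eq)
    finally have "?m * d \<le> u x" using mpos by (simp add: field_simps)
    then show ?thesis using x spM by (simp add: D_def)
  qed
  then show ?thesis using that D mD by blast
qed

text \<open>For fixed \<open>d\<close>, the sets of the previous lemma for larger and larger indices are measurable
  covers of arbitrarily small measure, so the elements with partner measure at least \<open>d\<close> lie in a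
  null set. The values \<open>d = 1 / (n + 1)\<close> exhaust all elements with positive partner measure.\<close>
lemma pro_p_positive_null_if_unbounded_index:
  assumes p: "prime p" and pf: "profinite_group G T"
    and haar: "normalized_haar_measure G T M"
    and unb: "\<And>b. \<exists>P. subgroup P G \<and> openin T P \<and> \<not> p dvd subgroup_index G P \<and>
      b < subgroup_index G P"
  shows "measure M (pro_p_positive p G T M) = 0"
proof -
  have spM: "space M = carrier G" and M1: "emeasure M (carrier G) = 1"
    using haar by (auto simp: normalized_haar_measure_def)
  interpret finite_measure M by (rule finite_measureI) (simp add: spM M1)
  let ?B = "\<lambda>d. {x \<in> carrier G. d \<le> measure M (pro_p_partners p G T x)}"
  have small: "\<exists>D \<in> sets M. ?B d \<subseteq> D \<and> measure M D < e" if d: "d > 0" and e: "e > 0" for d e :: real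
  proof -
    obtain b :: nat where b: "1 / (d * e) < real b" using reals_Archimedean2 by blast
    obtain P where P: "subgroup P G" "openin T P" "\<not> p dvd subgroup_index G P"
      "b < subgroup_index G P" using unb by blast
    obtain D where D: "D \<in> sets M" "measure M D \<le> 1 / (real (subgroup_index G P) * d)" "?B d \<subseteq> D"
      using many_partners_small_measure[OF p pf haar P(1-3) d] .
    have "1 / (d * e) < real (subgroup_index G P)" using b P(4) by simp
    then have "1 / (real (subgroup_index G P) * d) < e"
      using d e P(4) by (simp add: field_simps)
    then have "measure M D < e" using D(2) by linarith
    then show ?thesis using D(1,3) by blast
  qed
  have null: "\<exists>Z \<in> null_sets M. ?B d \<subseteq> Z" if d: "d > 0" for d :: real
  proof -
    have "\<exists>D \<in> sets M. ?B d \<subseteq> D \<and> measure M D < 1 / real (Suc n)" for n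
      using small[OF d, of "1 / real (Suc n)"] by simp
    then obtain D where D: "\<And>n. D n \<in> sets M" "\<And>n. ?B d \<subseteq> D n"
      "\<And>n. measure M (D n) < 1 / real (Suc n)" by metis
    have I: "(\<Inter>n. D n) \<in> sets M" using D(1) by auto
    have "measure M (\<Inter>n. D n) < 1 / real (Suc n)" for n
    proof -
      have "measure M (\<Inter>n. D n) \<le> measure M (D n)"
        by (intro finite_measure_mono INT_lower D(1) UNIV_I)
      then show ?thesis using D(3)[of n] by linarith
    qed
    then have "\<not> inverse (real (Suc n)) < measure M (\<Inter>n. D n)" for n
      by (metis inverse_eq_divide order_less_asym)
    then have "measure M (\<Inter>n. D n) \<le> 0"
      using reals_Archimedean[of "measure M (\<Inter>n. D n)"] by (meson not_le)
    then have "(\<Inter>n. D n) \<in> null_sets M"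
      using I by (simp add: null_sets_def emeasure_eq_measure measure_le_0_iff)
    then show ?thesis using D(2) by blast
  qed
  have "\<exists>Z \<in> null_sets M. ?B (1 / real (Suc n)) \<subseteq> Z" for n by (rule null) simp
  then obtain Z where Z: "\<And>n. Z n \<in> null_sets M" "\<And>n. ?B (1 / real (Suc n)) \<subseteq> Z n" by metis
  have "pro_p_positive p G T M \<subseteq> (\<Union>n. Z n)"
  proof
    fix x assume "x \<in> pro_p_positive p G T M"
    then have x: "x \<in> carrier G" "0 < measure M (pro_p_partners p G T x)"
      by (auto simp: pro_p_positive_def)
    obtain n where "inverse (real (Suc n)) < measure M (pro_p_partners p G T x)"
      using reals_Archimedean[OF x(2)] by blast
    then have "x \<in> ?B (1 / real (Suc n))" using x(1) by (simp add: inverse_eq_divide)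
    then show "x \<in> (\<Union>n. Z n)" using Z(2) by blast
  qed
  moreover have "(\<Union>n. Z n) \<in> null_sets M" using Z(1) by (rule null_sets_UN)
  ultimately have "emeasure M (pro_p_positive p G T M) = 0"
    using emeasure_mono[of "pro_p_positive p G T M" "\<Union>n. Z n" M]
    by (simp add: null_setsD1 null_setsD2)
  then show ?thesis by (simp add: measure_def)
qed

end

section \<open>Subgroups of maximal index prime to p\<close>

text \<open>For \<open>N\<close> open and normal in \<open>P\<close>, the preimage \<open>Q\<close> of a Sylow \<open>p\<close>-subgroup of \<open>P / N\<close> has index
  prime to \<open>p\<close> in \<open>P\<close>, hence in \<open>G\<close>. Maximality of the index of \<open>P\<close> forces \<open>Q = P\<close>, so \<open>P / N\<close>
  equals its Sylow subgroup.\<close>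
lemma maximal_index_imp_pro_p_subgroup:
  fixes G :: "('a, 'b) monoid_scheme" and T :: "'a topology"
  assumes p: "prime p" and pf: "profinite_group G T"
    and P: "subgroup P G" "openin T P" and pP: "\<not> p dvd subgroup_index G P"
    and max: "\<And>Q. subgroup Q G \<Longrightarrow> openin T Q \<Longrightarrow> \<not> p dvd subgroup_index G Q \<Longrightarrow>
      subgroup_index G Q \<le> subgroup_index G P"
  shows "pro_p_subgroup p G T P"
proof -
  have tg: "topological_group G T" using pf by (auto simp: profinite_group_def)
  interpret group G using tg by (simp add: topological_group_def)
  let ?P = "G\<lparr>carrier := P\<rparr>" and ?TP = "subtopology T P"
  have pfP: "profinite_group ?P ?TP" by (rule profinite_open_subgroup[OF pf P])
  have tgP: "topological_group ?P ?TP" and compP: "compact_space ?TP"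
    using pfP by (auto simp: profinite_group_def)
  interpret GP: group ?P using subgroup.subgroup_is_group[OF P(1) group_axioms] .
  have "finite_p_group p (?P Mod N)" if N: "N \<lhd> ?P" and No: "openin ?TP N" for N
  proof -
    have Ns: "subgroup N ?P" using N by (rule normal_imp_subgroup)
    have fin: "finite (lcosets\<^bsub>?P\<^esub> N)" by (rule finite_lcosets_open_subgroup[OF tgP compP Ns No])
    obtain Q n where Q: "subgroup Q ?P" "N \<subseteq> Q" "\<not> p dvd subgroup_index ?P Q"
      "subgroup_index (?P\<lparr>carrier := Q\<rparr>) N = p ^ n"
      by (rule GP.sylow_above_normal[OF p N fin])
    have QG: "subgroup Q G" by (rule incl_subgroup[OF P(1) Q(1)])
    have QP: "Q \<subseteq> P" using subgroup.subset[OF Q(1)] by simp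
    have "openin ?TP Q" by (rule openin_subgroup_mono[OF tgP Ns No Q(1,2)])
    then have Qo: "openin T Q" using P(2) by (simp add: openin_open_subtopology)
    have iQ: "subgroup_index G Q = subgroup_index G P * subgroup_index ?P Q"
      by (rule subgroup_index_mult[OF P(1) QG QP])
    then have "\<not> p dvd subgroup_index G Q"
      using pP Q(3) p by (simp add: prime_dvd_mult_iff)
    then have "subgroup_index G P * subgroup_index ?P Q \<le> subgroup_index G P * 1"
      using max[OF QG Qo] iQ by simp
    moreover have "subgroup_index G P > 0" "subgroup_index ?P Q > 0"
      using pP Q(3) by (auto intro: Nat.gr0I)
    ultimately have "subgroup_index ?P Q = 1" by simp
    then have "order (?P Mod N) = p ^ n"
      using GP.subgroup_index_mult[OF Q(1) Ns Q(2)] Q(4) GP.order_Mod_eq_subgroup_index[OF N] by simp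
    moreover have "group (?P Mod N)" by (rule normal.factorgroup_is_group[OF N])
    moreover have "finite (carrier (?P Mod N))"
      using calculation p by (metis group.is_monoid monoid.order_gt_0_iff_finite prime_gt_0_nat
          zero_less_power)
    ultimately show ?thesis by (auto simp: finite_p_group_def)
  qed
  then show ?thesis using pfP P(1) by (simp add: pro_p_subgroup_def pro_p_group_def)
qed

theorem theorem10:
  fixes G :: "('a, 'b) monoid_scheme" and T :: "'a topology" and M :: "'a measure" and p :: nat
  assumes "prime p"
    and "profinite_group G T"
    and "normalized_haar_measure G T M"
    and "measure M (pro_p_positive p G T M) > 0"
  shows "virtually_pro_p p G T"
proof -
  have tg: "topological_group G T" using assms(2) by (auto simp: profinite_group_def)
  interpret group G using tg by (simp add: topological_group_def)
  let ?Q = "\<lambda>P. subgroup P G \<and> openin T P \<and> \<not> p dvd subgroup_index G P"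
  have "\<exists>b. \<forall>P. ?Q P \<longrightarrow> subgroup_index G P \<le> b"
  proof (rule ccontr)
    assume "\<not> ?thesis"
    then have "\<exists>P. subgroup P G \<and> openin T P \<and> \<not> p dvd subgroup_index G P \<and>
      b < subgroup_index G P" for b by (metis not_le)
    then show False
      using pro_p_positive_null_if_unbounded_index[OF assms(1-3)] assms(4) by simp
  qed
  then obtain b where b: "\<And>P. ?Q P \<Longrightarrow> subgroup_index G P < Suc b" by (meson less_Suc_eq_le)
  have "lcosets\<^bsub>G\<^esub> (carrier G) = {carrier G}"
    using lcosets_transitive[OF subgroup_self, of "carrier G"] coset_join3[OF _ subgroup_self]
    by (auto simp: lcosets_eq_image)
  then have "subgroup_index G (carrier G) = 1" by (simp add: subgroup_index_def)
  moreover have "openin T (carrier G)"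
    using tg by (metis openin_topspace topological_group_def)
  ultimately have "?Q (carrier G)"
    using not_prime_unit[of p] assms(1) subgroup_self by auto
  from ex_has_greatest_nat[of ?Q, OF this, of "subgroup_index G" "Suc b"] b
  obtain P where P: "?Q P" "\<And>Q. ?Q Q \<Longrightarrow> subgroup_index G Q \<le> subgroup_index G P"
    by (meson less_imp_le)
  have "pro_p_subgroup p G T P"
    by (rule maximal_index_imp_pro_p_subgroup[OF assms(1,2)]) (use P in auto)
  then show ?thesis using P(1) by (auto simp: virtually_pro_p_def)
qed

end
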